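(* If the sequence $(u_n)_{n\ge0}$ does not contain zeroes but contains negative terms, then the function $f$ is nowhere monotonic on the closed interval $[0,1]$, i.e. there is no non-degenerate subinterval of $[0,1]$ on which $f$ is monotonic.
   Context: Let $\mathbb{Z}_0=\{0,1,2,\dots\}$. Every $x\in(0,1]$ has a unique $E$-representation, i.e. there is a unique sequence $(g_n(x))_{n\ge 1}$ of elements of $\mathbb{Z}_0$ with $x=\sum_{n=1}^\infty \frac{1}{(2+g_1)(2+g_1+g_2)\cdots(2+g_1+\dots+g_n)}$, where $g_n=g_n(x)$; this is written $x=\Delta^E_{g_1g_2\ldots g_n\ldots}$. Conversely, every sequence in $\mathbb{Z}_0$ is the $E$-representation of some $x\in(0,1]$. Standing assumptions: $(u_n)_{n\ge0}$ is a sequence of real numbers such that $\sum_{n=0}^\infty u_n$ converges with sum $1$, $|u_n|<1$ for all $n\ge 0$, and $r_n:=\sum_{i=n+1}^\infty u_i=1-(u_0+\dots+u_n)$ satisfies $0<r_n<1$ for all $n\ge0$. The function $f$ is defined on $(0,1]$ by $f(x)=r_{g_1(x)}+\sum_{k=2}^\infty\bigl(r_{g_k(x)}\prod_{i=1}^{k-1}u_{g_i(x)}\bigr)$ (the series converges absolutely), and $f(0):=0$. *)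

theory Defs
  imports "HOL-Analysis.Analysis"
begin

text \<open>
  Digit sequences are indexed from 0, so \<open>g 0\<close> is the first digit \<open>g\<^sub>1\<close>.
\<close>

definition is_E_rep :: "(nat \<Rightarrow> nat) \<Rightarrow> real \<Rightarrow> bool" where
  "is_E_rep g x \<longleftrightarrow> (\<lambda>n. 1 / (\<Prod>k\<le>n. real (2 + (\<Sum>i\<le>k. g i)))) sums x"

text \<open>
  The representation exists and is unique precisely for \<open>x\<close> in \<open>{0<..1}\<close>;
  elsewhere the value is unspecified.
\<close>

definition E_digits :: "real \<Rightarrow> nat \<Rightarrow> nat" where
  "E_digits x = (THE g. is_E_rep g x)"

definition tail_sum :: "(nat \<Rightarrow> real) \<Rightarrow> nat \<Rightarrow> real" where
  "tail_sum u n = (\<Sum>i. u (i + Suc n))"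

text \<open>Only the values on \<open>{0..1}\<close> are meaningful.\<close>

definition E_fun :: "(nat \<Rightarrow> real) \<Rightarrow> real \<Rightarrow> real" where
  "E_fun u x =
    (if x = 0 then 0
     else tail_sum u (E_digits x 0) +
       (\<Sum>k. tail_sum u (E_digits x (Suc k)) * (\<Prod>i\<le>k. u (E_digits x i))))"

definition nowhere_monotonic_on :: "real set \<Rightarrow> (real \<Rightarrow> real) \<Rightarrow> bool" where
  "nowhere_monotonic_on S f \<longleftrightarrow>
    \<not> (\<exists>I. I \<subseteq> S \<and> is_interval I \<and> (\<exists>a\<in>I. \<exists>b\<in>I. a < b) \<and>
        (mono_on I f \<or> antimono_on I f))"

end

theory Submission
  imports Defs
begin

text \<open>
  Sequences with a common prefix \<open>cs\<close> are mapped by \<open>f\<close> through one affine map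
  \<open>t \<mapsto> A + P t\<close>, where \<open>P\<close> is the product of the \<open>u\<^sub>c\<close>, hence nonzero. The sequences
  \<open>cs n 0 0 0 \<dots>\<close> represent points strictly decreasing in \<open>n\<close>, and between \<open>n\<close> and \<open>n + 1\<close>
  the function drops by \<open>P u\<^sub>n\<close>. Since \<open>u\<^sub>0 > 0\<close> and some \<open>u\<^sub>m < 0\<close>, both signs occur; and
  every interval contains all points of some such cylinder.
\<close>

section \<open>The Engel-type expansion\<close>

text \<open>
  The offset \<open>s\<close> is the sum of the digits already consumed; it makes the expansion
  self-similar under removing the first digit.
\<close>

definition E_term :: "nat \<Rightarrow> (nat \<Rightarrow> nat) \<Rightarrow> nat \<Rightarrow> real" where
  "E_term s g n = 1 / (\<Prod>k\<le>n. real (s + 2 + (\<Sum>i\<le>k. g i)))"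

definition E_value :: "nat \<Rightarrow> (nat \<Rightarrow> nat) \<Rightarrow> real" where
  "E_value s g = (\<Sum>n. E_term s g n)"

lemma case_nat_eta: "case_nat (g 0) (\<lambda>i. g (Suc i)) = g"
  by (auto split: nat.split)

lemma E_term_pos: "0 < E_term s g n"
  unfolding E_term_def by (intro divide_pos_pos prod_pos ballI) (simp_all del: of_nat_add of_nat_sum)

lemma E_term_le: "E_term s g n \<le> (1 / real (s + 2)) ^ Suc n"
proof -
  have "real (s + 2) ^ Suc n = (\<Prod>k\<le>n. real (s + 2))"
    by simp
  also have "\<dots> \<le> (\<Prod>k\<le>n. real (s + 2 + (\<Sum>i\<le>k. g i)))"
    by (intro prod_mono) (simp del: of_nat_add of_nat_sum)
  finally show ?thesis
    unfolding E_term_def power_one_over 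
    by (intro divide_left_mono mult_pos_pos prod_pos ballI) (simp_all del: of_nat_add of_nat_sum)
qed

lemma geometric_sums_inverse_Suc: "(\<lambda>n. (1 / real (s + 2)) ^ Suc n) sums (1 / real (s + 1))"
proof -
  have "(\<lambda>n. (1 / real (s + 2)) * (1 / real (s + 2)) ^ n)
      sums ((1 / real (s + 2)) * (1 / (1 - 1 / real (s + 2))))"
    by (intro sums_mult geometric_sums) auto
  moreover have "(1 / real (s + 2)) * (1 / (1 - 1 / real (s + 2))) = 1 / real (s + 1)"
    by (simp add: field_simps)
  ultimately show ?thesis by simp
qed

lemma summable_E_term: "summable (E_term s g)"
proof (rule summable_comparison_test)
  show "\<exists>N. \<forall>n\<ge>N. norm (E_term s g n) \<le> (1 / real (s + 2)) ^ Suc n"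
    using E_term_le[of s g] E_term_pos[of s g] by (auto simp: abs_of_pos simp del: power_Suc)
  show "summable (\<lambda>n. (1 / real (s + 2)) ^ Suc n)"
    using geometric_sums_inverse_Suc sums_summable by blast
qed

lemma E_value_pos: "0 < E_value s g"
  unfolding E_value_def by (intro suminf_pos summable_E_term E_term_pos)

text \<open>Comparison with the geometric series of ratio \<open>1 / (s + 2)\<close>, which is the
  expansion whose digits are all zero.\<close>

lemma E_value_le: "E_value s g \<le> 1 / real (s + 1)"
  unfolding E_value_def
  using suminf_le[OF E_term_le summable_E_term sums_summable[OF geometric_sums_inverse_Suc]]
  by (simp only: sums_unique[OF geometric_sums_inverse_Suc, symmetric])

lemma E_term_case_nat_0: "E_term s (case_nat d g) 0 = 1 / real (s + d + 2)"
  by (simp add: E_term_def)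

lemma E_term_case_nat_Suc:
  "E_term s (case_nat d g) (Suc n) = E_term (s + d) g n / real (s + d + 2)"
  unfolding E_term_def
  by (subst prod.atMost_Suc_shift)
    (simp add: sum.atMost_Suc_shift algebra_simps del: sum.atMost_Suc prod.atMost_Suc)

text \<open>The factor \<open>s + d + 2\<close> occurs in every denominator; taking it out leaves
  the expansion of \<open>g\<close> with offset \<open>s + d\<close>. Later arguments about values
  go through this recursion.\<close>

lemma E_value_case_nat:
  "E_value s (case_nat d g) = (1 + E_value (s + d) g) / real (s + d + 2)"
proof -
  have "E_value s (case_nat d g) =
      (\<Sum>n. E_term s (case_nat d g) (Suc n)) + E_term s (case_nat d g) 0"
    unfolding E_value_def using suminf_split_head[OF summable_E_term] by simp
  also have "(\<Sum>n. E_term s (case_nat d g) (Suc n)) = E_value (s + d) g / real (s + d + 2)"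
    unfolding E_term_case_nat_Suc E_value_def by (rule suminf_divide[OF summable_E_term])
  finally show ?thesis
    by (simp add: E_term_case_nat_0 add_divide_distrib del: of_nat_add)
qed

text \<open>With \<open>E_value_le_first_digit\<close> this locates the value in the half-open
  interval from \<open>1 / (s + d + 2)\<close> to \<open>1 / (s + d + 1)\<close>, where
  \<open>d\<close> is the first digit. These intervals are disjoint and move left as
  \<open>d\<close> grows.\<close>

lemma E_value_gt: "1 / real (s + g 0 + 2) < E_value s g"
proof -
  have "E_value s g = (1 + E_value (s + g 0) (\<lambda>i. g (Suc i))) / real (s + g 0 + 2)"
    by (metis E_value_case_nat case_nat_eta)
  then show ?thesis
    using E_value_pos[of "s + g 0" "\<lambda>i. g (Suc i)"] by (simp add: divide_strict_right_mono)
qed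

lemma E_value_le_first_digit: "E_value s g \<le> 1 / real (s + g 0 + 1)"
proof -
  have "E_value s g = (1 + E_value (s + g 0) (\<lambda>i. g (Suc i))) / real (s + g 0 + 2)"
    by (metis E_value_case_nat case_nat_eta)
  also have "\<dots> \<le> (1 + 1 / real (s + g 0 + 1)) / real (s + g 0 + 2)"
    by (intro divide_right_mono add_left_mono E_value_le) auto
  also have "\<dots> = 1 / real (s + g 0 + 1)"
    by (simp add: divide_simps)
  finally show ?thesis .
qed

lemma E_value_first_digit_less:
  assumes "g 0 < h 0"
  shows "E_value s h < E_value s g"
proof -
  have "E_value s h \<le> 1 / real (s + h 0 + 1)" by (rule E_value_le_first_digit)
  also have "\<dots> \<le> 1 / real (s + g 0 + 2)"
    using assms by (intro divide_left_mono) auto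
  also have "\<dots> < E_value s g" by (rule E_value_gt)
  finally show ?thesis .
qed

text \<open>Disjointness of the first-digit intervals forces equal first digits; the recursion then
  cancels to equal values of the tails at a common new offset, so the induction has to generalize
  over \<open>s\<close>.\<close>

lemma E_value_inject:
  assumes "E_value s g = E_value s h"
  shows "g = h"
proof
  fix n
  show "g n = h n"
    using assms
  proof (induction n arbitrary: s g h)
    case 0
    then show ?case
      using E_value_first_digit_less[of g h s] E_value_first_digit_less[of h g s] by linarith
  next
    case (Suc n)
    have eq: "g 0 = h 0"
      using Suc.prems E_value_first_digit_less[of g h s] E_value_first_digit_less[of h g s]
      by linarith
    have "E_value s g = (1 + E_value (s + g 0) (\<lambda>i. g (Suc i))) / real (s + g 0 + 2)"
      and "E_value s h = (1 + E_value (s + h 0) (\<lambda>i. h (Suc i))) / real (s + h 0 + 2)"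
      by (metis E_value_case_nat case_nat_eta)+
    then have "E_value (s + g 0) (\<lambda>i. g (Suc i)) = E_value (s + g 0) (\<lambda>i. h (Suc i))"
      using Suc.prems eq by simp
    then show ?case by (rule Suc.IH)
  qed
qed

lemma is_E_rep_iff: "is_E_rep g x \<longleftrightarrow> x = E_value 0 g"
proof -
  have "E_term 0 g sums E_value 0 g"
    unfolding E_value_def by (rule summable_sums[OF summable_E_term])
  moreover have "is_E_rep g x \<longleftrightarrow> E_term 0 g sums x"
    by (simp add: is_E_rep_def E_term_def[abs_def])
  ultimately show ?thesis by (auto dest: sums_unique2)
qed

text \<open>Injectivity settles the \<open>THE\<close>, so \<open>E_fun\<close> can be evaluated at
  any point given by its digits.\<close>

lemma E_digits_E_value: "E_digits (E_value 0 g) = g"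
  unfolding E_digits_def is_E_rep_iff by (rule the_equality) (auto dest: E_value_inject)

section \<open>Cylinders\<close>

text \<open>\<open>foldr case_nat cs g\<close> is \<open>g\<close> preceded by the digits
  \<open>cs\<close>. Each digit \<open>d\<close> acts by the increasing map
  \<open>v \<mapsto> (1 + v) / (s + d + 2)\<close>. The prefix changes the offset, hence the
  assumption for every \<open>s\<close>.\<close>

lemma E_value_prefix_less:
  assumes "\<And>s. E_value s g < E_value s h"
  shows "E_value s (foldr case_nat cs g) < E_value s (foldr case_nat cs h)"
  using assms
  by (induction cs arbitrary: s) (simp_all add: E_value_case_nat divide_strict_right_mono)

lemma exists_first_digit:
  assumes "0 < y" "y \<le> 1 / real (s + 1)"
  shows "\<exists>d. 1 / real (s + d + 2) < y \<and> y \<le> 1 / real (s + d + 1)"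
proof -
  \<comment> \<open>The least index whose left endpoint lies below \<open>y\<close>. By minimality
    \<open>y\<close> does not exceed the previous left endpoint, which is the right endpoint for
    \<open>k\<close>; if \<open>k = 0\<close>, the assumed upper bound on \<open>y\<close> takes
    that role.\<close>
  define k where "k = (LEAST k. 1 / real (s + k + 2) < y)"
  obtain n where "1 / real (Suc n) < y"
    using assms(1) reals_Archimedean[of y] by (auto simp: inverse_eq_divide)
  moreover have "1 / real (s + n + 2) \<le> 1 / real (Suc n)"
    by (intro divide_left_mono) auto
  ultimately have ex: "1 / real (s + n + 2) < y" by linarith
  have k: "1 / real (s + k + 2) < y"
    unfolding k_def using ex by (rule LeastI)
  have "y \<le> 1 / real (s + k + 1)"
  proof (cases k)
    case 0
    then show ?thesis using assms(2) by simp
  next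
    case (Suc j)
    have "\<not> 1 / real (s + j + 2) < y"
      using Suc not_less_Least[of j "\<lambda>k. 1 / real (s + k + 2) < y"] by (simp add: k_def)
    then show ?thesis using Suc by (simp add: not_less add_ac)
  qed
  with k show ?thesis by blast
qed

text \<open>The prefix consists of the first \<open>m\<close> digits of \<open>y\<close>, found one
  at a time; each digit contracts distances by a factor of at most 1/2.\<close>

lemma exists_cylinder_near:
  assumes "0 < y" "y \<le> 1 / real (s + 1)"
  shows "\<exists>cs. \<forall>t. \<bar>E_value s (foldr case_nat cs t) - y\<bar> \<le> (1/2) ^ m"
  using assms
proof (induction m arbitrary: s y)
  case 0
  have "\<bar>E_value s t - y\<bar> \<le> 1" for t
  proof -
    have "1 / real (s + 1) \<le> 1" by simp
    then show ?thesis
      using 0 E_value_pos[of s t] E_value_le[of s t] by linarith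
  qed
  then show ?case by (intro exI[of _ "[]"]) simp
next
  case (Suc m)
  obtain d where d: "1 / real (s + d + 2) < y" "y \<le> 1 / real (s + d + 1)"
    using exists_first_digit[OF Suc.prems] by blast
  \<comment> \<open>The preimage of \<open>y\<close> under the map of the digit \<open>d\<close>.
    The bounds on \<open>y\<close> place it in the range required at offset
    \<open>s + d\<close>.\<close>
  define y' where "y' = y * real (s + d + 2) - 1"
  have "0 < y'" using d(1) by (simp add: y'_def field_simps)
  moreover have "y' \<le> 1 / real (s + d + 1)"
  proof -
    have "y * real (s + d + 2) \<le> 1 / real (s + d + 1) * real (s + d + 2)"
      using d(2) by (intro mult_right_mono) auto
    also have "\<dots> = 1 + 1 / real (s + d + 1)"
      by (simp add: divide_simps)
    finally show ?thesis by (simp add: y'_def)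
  qed
  ultimately obtain cs where
    cs: "\<And>t. \<bar>E_value (s + d) (foldr case_nat cs t) - y'\<bar> \<le> (1/2) ^ m"
    using Suc.IH by blast
  have y: "y = (1 + y') / real (s + d + 2)"
    unfolding y'_def by (simp add: field_simps)
  have "\<bar>E_value s (foldr case_nat (d # cs) t) - y\<bar> \<le> (1/2) ^ Suc m" for t
  proof -
    have "E_value s (foldr case_nat (d # cs) t) - y
        = (E_value (s + d) (foldr case_nat cs t) - y') / real (s + d + 2)"
      unfolding y by (simp add: E_value_case_nat diff_divide_distrib add_divide_distrib)
    then have "\<bar>E_value s (foldr case_nat (d # cs) t) - y\<bar>
        = \<bar>E_value (s + d) (foldr case_nat cs t) - y'\<bar> / real (s + d + 2)"
      by (simp add: abs_divide)
    also have "\<dots> \<le> (1/2) ^ m / 2"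
      by (intro frac_le cs) auto
    finally show ?thesis by simp
  qed
  then show ?case by blast
qed

section \<open>The function on digit sequences\<close>

definition digit_fun :: "(nat \<Rightarrow> real) \<Rightarrow> (nat \<Rightarrow> nat) \<Rightarrow> real" where
  "digit_fun u g = tail_sum u (g 0) + (\<Sum>k. tail_sum u (g (Suc k)) * (\<Prod>i\<le>k. u (g i)))"

lemma E_fun_E_value: "E_fun u (E_value 0 g) = digit_fun u g"
  using E_value_pos[of 0 g] by (simp add: E_fun_def digit_fun_def E_digits_E_value)

lemma tail_sum_Suc:
  assumes "summable u"
  shows "tail_sum u n = u (Suc n) + tail_sum u (Suc n)"
  unfolding tail_sum_def
  using suminf_split_head[of "\<lambda>i. u (i + Suc n)"] summable_ignore_initial_segment[OF assms, of "Suc n"]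
  by simp

lemma tail_sum_0:
  assumes "u sums 1"
  shows "tail_sum u 0 = 1 - u 0"
  using suminf_split_head[OF sums_summable[OF assms]] sums_unique[OF assms]
  by (simp add: tail_sum_def)

text \<open>Convergence to 0 leaves only finitely many terms of modulus 1/2 or more, and their
  maximum is still below 1.\<close>

lemma uniform_bound_less_1:
  fixes u :: "nat \<Rightarrow> real"
  assumes "u \<longlonglongrightarrow> 0" "\<And>n. \<bar>u n\<bar> < 1"
  shows "\<exists>q<1. \<forall>n. \<bar>u n\<bar> \<le> q"
proof -
  obtain N where N: "\<And>n. n \<ge> N \<Longrightarrow> \<bar>u n\<bar> < 1/2"
    using LIMSEQ_D[OF assms(1), of "1/2"] by auto
  define q where "q = Max (insert (1/2) ((\<lambda>n. \<bar>u n\<bar>) ` {..<N}))"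
  have "q < 1"
    using assms(2) by (auto simp: q_def)
  moreover have "\<bar>u n\<bar> \<le> q" for n
  proof (cases "n < N")
    case True
    then show ?thesis unfolding q_def by (intro Max_ge) auto
  next
    case False
    then have "\<bar>u n\<bar> \<le> 1/2" using N[of n] by simp
    also have "\<dots> \<le> q" unfolding q_def by (intro Max_ge) auto
    finally show ?thesis .
  qed
  ultimately show ?thesis by blast
qed

text \<open>A product of \<open>k + 1\<close> factors bounded by \<open>q < 1\<close> gives the
  geometric majorant \<open>q ^ Suc k\<close>.\<close>

lemma summable_digit_fun:
  assumes "u \<longlonglongrightarrow> 0" "\<And>n. \<bar>u n\<bar> < 1" "\<And>n. \<bar>tail_sum u n\<bar> \<le> 1"
  shows "summable (\<lambda>k. tail_sum u (g (Suc k)) * (\<Prod>i\<le>k. u (g i)))"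
proof -
  obtain q where q: "q < 1" "\<And>n. \<bar>u n\<bar> \<le> q"
    using uniform_bound_less_1[OF assms(1,2)] by blast
  have "0 \<le> q" using q(2)[of 0] by linarith
  show ?thesis
  proof (rule summable_comparison_test)
    have "\<bar>tail_sum u (g (Suc k)) * (\<Prod>i\<le>k. u (g i))\<bar> \<le> 1 * (\<Prod>i\<le>k. q)" for k
      unfolding abs_mult abs_prod
      by (intro mult_mono assms(3) prod_mono prod_nonneg) (auto simp: q(2))
    then show "\<exists>N. \<forall>k\<ge>N. norm (tail_sum u (g (Suc k)) * (\<Prod>i\<le>k. u (g i))) \<le> q ^ Suc k"
      by simp
    show "summable (\<lambda>k. q ^ Suc k)"
      using \<open>0 \<le> q\<close> q(1) by (simp add: summable_mult summable_geometric)
  qed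
qed

text \<open>Every term of the series contains the factor \<open>u d\<close>. After taking it out,
  the term at index 0 supplies the leading \<open>tail_sum u (g 0)\<close> of
  \<open>digit_fun u g\<close>.\<close>

lemma digit_fun_case_nat:
  assumes "u \<longlonglongrightarrow> 0" "\<And>n. \<bar>u n\<bar> < 1" "\<And>n. \<bar>tail_sum u n\<bar> \<le> 1"
  shows "digit_fun u (case_nat d g) = tail_sum u d + u d * digit_fun u g"
proof -
  let ?a = "\<lambda>k. tail_sum u (case_nat d g (Suc k)) * (\<Prod>i\<le>k. u (case_nat d g i))"
  have "?a (Suc k) = u d * (tail_sum u (g (Suc k)) * (\<Prod>i\<le>k. u (g i)))" for k
    by (simp add: prod.atMost_Suc_shift del: prod.atMost_Suc)
  then have "(\<Sum>k. ?a (Suc k)) = u d * (\<Sum>k. tail_sum u (g (Suc k)) * (\<Prod>i\<le>k. u (g i)))"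
    by (simp only: suminf_mult[OF summable_digit_fun[OF assms]])
  moreover have "(\<Sum>k. ?a (Suc k)) = (\<Sum>k. ?a k) - ?a 0"
    by (rule suminf_split_head[OF summable_digit_fun[OF assms]])
  ultimately show ?thesis
    by (simp add: digit_fun_def algebra_simps)
qed

lemma digit_fun_prefix:
  assumes "u \<longlonglongrightarrow> 0" "\<And>n. \<bar>u n\<bar> < 1" "\<And>n. \<bar>tail_sum u n\<bar> \<le> 1" "\<And>n. u n \<noteq> 0"
  shows "\<exists>A P. P \<noteq> 0 \<and> (\<forall>t. digit_fun u (foldr case_nat cs t) = A + P * digit_fun u t)"
proof (induction cs)
  case Nil
  show ?case by (intro exI[of _ 0] exI[of _ 1]) simp
next
  case (Cons c cs)
  then obtain A P where
    "P \<noteq> 0" "\<And>t. digit_fun u (foldr case_nat cs t) = A + P * digit_fun u t"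
    by blast
  then show ?case
    using assms(4)[of c]
    by (intro exI[of _ "tail_sum u c + u c * A"] exI[of _ "u c * P"])
      (simp add: digit_fun_case_nat[OF assms(1-3)] algebra_simps)
qed

theorem theorem5:
  fixes u :: "nat \<Rightarrow> real"
  assumes "u sums 1"
    and "\<And>n. \<bar>u n\<bar> < 1"
    and "\<And>n. 0 < tail_sum u n \<and> tail_sum u n < 1"
    and "\<And>n. u n \<noteq> 0"
    and "\<exists>n. u n < 0"
  shows "nowhere_monotonic_on {0..1} (E_fun u)"
  unfolding nowhere_monotonic_on_def
proof (rule notI, elim exE conjE bexE)
  fix I and a b :: real
  assume I: "I \<subseteq> {0..1}" "is_interval I" "a \<in> I" "b \<in> I" "a < b"
    and mono: "mono_on I (E_fun u) \<or> antimono_on I (E_fun u)"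
  have lim: "u \<longlonglongrightarrow> 0"
    using assms(1) sums_summable summable_LIMSEQ_zero by blast
  have tail: "\<bar>tail_sum u n\<bar> \<le> 1" for n
    using assms(3)[of n] by simp
  note digit_step = digit_fun_case_nat[OF lim assms(2) tail]
  let ?t = "\<lambda>n. case_nat n (\<lambda>_. 0) :: nat \<Rightarrow> nat"

  \<comment> \<open>Prepending 0 does not change the zero sequence, so its value solves
    \<open>v = (1 - u 0) + u 0 * v\<close>; as \<open>u 0 < 1\<close>, the only solution is
    1.\<close>
  have zeros: "digit_fun u (\<lambda>_. 0) = 1"
  proof -
    have "?t 0 = (\<lambda>_. 0)" by (auto split: nat.split)
    then have "digit_fun u (\<lambda>_. 0) = (1 - u 0) + u 0 * digit_fun u (\<lambda>_. 0)"
      using digit_step[of 0 "\<lambda>_. 0"] tail_sum_0[OF assms(1)] by simp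
    then have "(1 - u 0) * (digit_fun u (\<lambda>_. 0) - 1) = 0"
      by (simp add: algebra_simps)
    then show ?thesis using assms(2)[of 0] by auto
  qed
  \<comment> \<open>The two values are \<open>tail_sum u n + u n\<close> and
    \<open>tail_sum u (Suc n) + u (Suc n)\<close>, and the latter equals
    \<open>tail_sum u n\<close>.\<close>
  have drop: "digit_fun u (?t n) - digit_fun u (?t (Suc n)) = u n" for n
    using tail_sum_Suc[OF sums_summable[OF assms(1)], of n] by (simp add: digit_step zeros)

  \<comment> \<open>A cylinder within half the length of \<open>[a, b]\<close> from its midpoint
    stays inside \<open>I\<close>.\<close>
  define y where "y = (a + b) / 2"
  have "a \<ge> 0" "b \<le> 1" using I by auto
  then have y: "0 < y" "y \<le> 1 / real (0 + 1)" using \<open>a < b\<close> by (auto simp: y_def)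
  obtain m where m: "(1/2::real) ^ m < (b - a) / 2"
    using real_arch_pow_inv[of "(b - a) / 2" "1/2"] \<open>a < b\<close> by auto
  obtain cs where cs: "\<And>t. \<bar>E_value 0 (foldr case_nat cs t) - y\<bar> \<le> (1/2) ^ m"
    using exists_cylinder_near[OF y] by blast
  obtain A P where P: "P \<noteq> 0"
    and AP: "\<And>t. digit_fun u (foldr case_nat cs t) = A + P * digit_fun u t"
    using digit_fun_prefix[OF lim assms(2) tail assms(4)] by blast

  define x where "x n = E_value 0 (foldr case_nat cs (?t n))" for n
  have in_I: "x n \<in> I" for n
  proof -
    have "\<bar>x n - y\<bar> \<le> (b - a) / 2"
      using less_imp_le[OF m] by (intro order_trans[OF cs[of "?t n", folded x_def]])
    then have "a \<le> x n" "x n \<le> b"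
      by (simp_all add: y_def abs_le_iff field_simps)
    then show ?thesis
      using I mem_is_interval_1_I by blast
  qed
  have x_less: "x (Suc n) < x n" for n
    unfolding x_def by (intro E_value_prefix_less E_value_first_digit_less) simp
  have f_drop: "E_fun u (x n) - E_fun u (x (Suc n)) = P * u n" for n
  proof -
    have "E_fun u (x n) - E_fun u (x (Suc n)) = P * (digit_fun u (?t n) - digit_fun u (?t (Suc n)))"
      by (simp only: x_def E_fun_E_value AP) (simp add: right_diff_distrib)
    then show ?thesis by (simp only: drop)
  qed

  \<comment> \<open>Here \<open>tail_sum u 0 < 1\<close> enters: it says that
    \<open>1 - u 0 < 1\<close>.\<close>
  have u0: "0 < u 0" using assms(3)[of 0] tail_sum_0[OF assms(1)] by simp
  obtain k where uk: "u k < 0" using assms(5) by blast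
  \<comment> \<open>The points \<open>x n\<close> decrease, so monotonicity in either direction
    gives all the drops \<open>P * u n\<close> one weak sign. As \<open>P\<close> is nonzero,
    \<open>u 0 > 0\<close> and \<open>u k < 0\<close> contradict this.\<close>
  have "(\<forall>n. 0 \<le> P * u n) \<or> (\<forall>n. P * u n \<le> 0)"
    using mono
  proof
    assume "mono_on I (E_fun u)"
    then have "E_fun u (x (Suc n)) \<le> E_fun u (x n)" for n
      using in_I x_less[of n] by (auto intro: mono_onD)
    then show ?thesis using f_drop by (metis diff_ge_0_iff_ge)
  next
    assume "antimono_on I (E_fun u)"
    then have "E_fun u (x n) \<le> E_fun u (x (Suc n))" for n
      using in_I x_less[of n] by (auto intro: monotone_onD)
    then show ?thesis using f_drop by (metis diff_le_0_iff_le)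
  qed
  then have "(0 \<le> P * u 0 \<and> 0 \<le> P * u k) \<or> (P * u 0 \<le> 0 \<and> P * u k \<le> 0)"
    by blast
  then show False
    using P u0 uk by (auto simp: zero_le_mult_iff mult_le_0_iff)
qed

end
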